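(* Let $(X,d)$ be a metric space with at least four points and let $A,B,C\in X$ be three fixed points. Put $a=d(B,C)$, $b=d(C,A)$, $c=d(A,B)$, and for $M\in X$ put $d_1=d(M,A)$, $d_2=d(M,B)$, $d_3=d(M,C)$, $\alpha_1(M)=4d_2^2d_3^2-\big(d_1^2-(d_2^2+d_3^2)\big)^2$ and $\beta_2(M)=d_3^2+d_1^2-d_2^2$. Then a point $M\in X$ fulfills $d_3+d_1-d_2\leq 0$ if and only if $\alpha_1(M)\leq 0$ and $\beta_2(M)\leq 0$. Moreover, if $(X,d)$ is a Ptolemaic metric space, then the set of points $M\in X$ fulfilling $d_3+d_1-d_2\leq 0$ is non-empty if and only if $c\geq b$ or $a\geq b$.
   Context: A metric space $(X,d)$ is called a Ptolemaic metric space if $d(x_1,x_2)\,d(x_3,x_4)\leq d(x_2,x_4)\,d(x_1,x_3)+d(x_1,x_4)\,d(x_2,x_3)$ for every $x_1,x_2,x_3,x_4\in X$. *)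

theory Defs
  imports "HOL-Analysis.Analysis"
begin

definition ptolemaic_space :: "'a set \<Rightarrow> ('a \<Rightarrow> 'a \<Rightarrow> real) \<Rightarrow> bool" where
  "ptolemaic_space X d \<longleftrightarrow> Metric_space X d \<and>
     (\<forall>x1\<in>X. \<forall>x2\<in>X. \<forall>x3\<in>X. \<forall>x4\<in>X.
        d x1 x2 * d x3 x4 \<le> d x2 x4 * d x1 x3 + d x1 x4 * d x2 x3)"

definition alpha1 :: "('a \<Rightarrow> 'a \<Rightarrow> real) \<Rightarrow> 'a \<Rightarrow> 'a \<Rightarrow> 'a \<Rightarrow> 'a \<Rightarrow> real" where
  "alpha1 d A B C M =
     (let d1 = d M A; d2 = d M B; d3 = d M C
      in 4 * d2\<^sup>2 * d3\<^sup>2 - (d1\<^sup>2 - (d2\<^sup>2 + d3\<^sup>2))\<^sup>2)"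

definition beta2 :: "('a \<Rightarrow> 'a \<Rightarrow> real) \<Rightarrow> 'a \<Rightarrow> 'a \<Rightarrow> 'a \<Rightarrow> 'a \<Rightarrow> real" where
  "beta2 d A B C M =
     (let d1 = d M A; d2 = d M B; d3 = d M C
      in d3\<^sup>2 + d1\<^sup>2 - d2\<^sup>2)"

end

theory Submission
  imports Defs
begin

text \<open>
  Up to reordering, \<open>alpha1\<close> is Heron's expression
  \<open>(x + y + z) (y + z - x) (x + z - y) (x + y - z)\<close> in the distances \<open>x\<close>, \<open>y\<close>, \<open>z\<close> from
  \<open>M\<close> to \<open>A\<close>, \<open>B\<close>, \<open>C\<close>. It is non-positive exactly when some factor is, that is, when one
  distance is at least the sum of the other two; the sign of \<open>beta2\<close> singles out the distance
  to \<open>B\<close> as the long one. This is a fact about three non-negative reals.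

  For the existence of such an \<open>M\<close>, the vertices \<open>A\<close> and \<open>C\<close> themselves serve as witnesses when
  \<open>c \<ge> b\<close> and \<open>a \<ge> b\<close> respectively. In the other direction, Ptolemy's inequality
  \<open>b y \<le> a x + c z\<close> combined with \<open>x + z \<le> y\<close> says that \<open>b (x + z)\<close> is at most \<open>a x + c z\<close>.
  If both \<open>a\<close> and \<open>c\<close> were smaller than \<open>b\<close>, this would force \<open>x = z = 0\<close>, so \<open>M\<close>
  would coincide with both \<open>A\<close> and \<open>C\<close>, and \<open>b\<close> would vanish.
\<close>

lemma heron_factorization:
  fixes x y z :: "'a :: comm_ring_1"
  shows "4 * y\<^sup>2 * z\<^sup>2 - (x\<^sup>2 - (y\<^sup>2 + z\<^sup>2))\<^sup>2
       = (x + y + z) * (y + z - x) * (z + x - y) * (x + y - z)"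
  by (simp add: power2_eq_square algebra_simps)

text \<open>
  The condition \<open>z\<^sup>2 + x\<^sup>2 \<le> y\<^sup>2\<close> makes \<open>y\<close> the largest of the three numbers, so \<open>z + x - y\<close>
  is the only Heron factor that can be negative. The remaining factors can vanish only if \<open>x\<close> or
  \<open>z\<close> does, and then \<open>z + x \<le> y\<close> holds anyway.
\<close>

lemma degenerate_iff_heron_nonpos_and_obtuse:
  fixes x y z :: "'a :: linordered_idom"
  assumes "x \<ge> 0" "y \<ge> 0" "z \<ge> 0"
  shows "z + x - y \<le> 0 \<longleftrightarrow>
    4 * y\<^sup>2 * z\<^sup>2 - (x\<^sup>2 - (y\<^sup>2 + z\<^sup>2))\<^sup>2 \<le> 0 \<and> z\<^sup>2 + x\<^sup>2 - y\<^sup>2 \<le> 0"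
proof
  assume le: "z + x - y \<le> 0"
  have "(x + y + z) * (y + z - x) * (z + x - y) * (x + y - z) \<le> 0"
    using assms le by (intro mult_nonpos_nonneg mult_nonneg_nonpos mult_nonneg_nonneg) auto
  moreover have "z\<^sup>2 + x\<^sup>2 \<le> y\<^sup>2"
  proof -
    have "z\<^sup>2 + x\<^sup>2 \<le> (z + x)\<^sup>2"
      using assms by (simp add: power2_sum)
    also have "\<dots> \<le> y\<^sup>2"
      using assms le by (intro power_mono) auto
    finally show ?thesis .
  qed
  ultimately show "4 * y\<^sup>2 * z\<^sup>2 - (x\<^sup>2 - (y\<^sup>2 + z\<^sup>2))\<^sup>2 \<le> 0 \<and> z\<^sup>2 + x\<^sup>2 - y\<^sup>2 \<le> 0"
    by (simp add: heron_factorization)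
next
  assume R: "4 * y\<^sup>2 * z\<^sup>2 - (x\<^sup>2 - (y\<^sup>2 + z\<^sup>2))\<^sup>2 \<le> 0 \<and> z\<^sup>2 + x\<^sup>2 - y\<^sup>2 \<le> 0"
  show "z + x - y \<le> 0"
  proof (rule ccontr)
    assume "\<not> z + x - y \<le> 0"
    then have pos: "z + x - y > 0" by simp
    have obtuse: "z\<^sup>2 + x\<^sup>2 \<le> y\<^sup>2"
      using R by simp
    have "x\<^sup>2 \<le> y\<^sup>2" "z\<^sup>2 \<le> y\<^sup>2"
      using obtuse zero_le_power2[of x] zero_le_power2[of z] by linarith+
    then have "x \<le> y" "z \<le> y"
      using assms by (auto intro: power2_le_imp_le)
    then have "(x + y + z) * (y + z - x) * (z + x - y) * (x + y - z) > 0"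
      using assms pos by (intro mult_pos_pos) auto
    then show False
      using R by (simp add: heron_factorization)
  qed
qed

text \<open>
  Bounding \<open>d M B\<close> below by \<open>d M C + d M A\<close> in Ptolemy's inequality gives a non-positive
  combination of \<open>d M A\<close> and \<open>d M C\<close> with weights \<open>d C A - d B C\<close> and \<open>d C A - d A B\<close>.
  Both weights are positive if \<open>d C A\<close> is strictly the longest side, so both distances vanish.
\<close>

lemma ptolemaic_degenerate_imp_not_longest:
  assumes pt: "ptolemaic_space X d"
    and X: "A \<in> X" "B \<in> X" "C \<in> X" "M \<in> X"
    and le: "d M C + d M A \<le> d M B"
  shows "d A B \<ge> d C A \<or> d B C \<ge> d C A"
proof (rule ccontr)
  interpret Metric_space X d
    using pt by (simp add: ptolemaic_space_def)
  assume "\<not> ?thesis"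
  then have less: "d A B < d C A" "d B C < d C A" by auto
  have "d C A * (d M C + d M A) \<le> d C A * d M B"
    using le by (intro mult_left_mono) auto
  also have "\<dots> \<le> d A B * d C M + d C B * d A M"
    using pt X by (auto simp: ptolemaic_space_def)
  finally have sum: "(d C A - d A B) * d M C + (d C A - d B C) * d M A \<le> 0"
    by (simp add: commute algebra_simps)
  have "(d C A - d A B) * d M C \<ge> 0" "(d C A - d B C) * d M A \<ge> 0"
    using less by auto
  with sum have "(d C A - d A B) * d M C = 0" "(d C A - d B C) * d M A = 0"
    by linarith+
  then have "d M C = 0" "d M A = 0"
    using less by auto
  then have "C = A"
    using X by simp
  then show False
    using less(1) X nonneg[of A B] by simp
qed

theorem theorem10:
  fixes X :: "'a set" and d :: "'a \<Rightarrow> 'a \<Rightarrow> real"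
    and A B C :: 'a and a b c :: real
  assumes "Metric_space X d"
    and "infinite X \<or> card X \<ge> 4"
    and "A \<in> X" and "B \<in> X" and "C \<in> X"
    and "a = d B C" and "b = d C A" and "c = d A B"
  shows "(\<forall>M\<in>X. d M C + d M A - d M B \<le> 0 \<longleftrightarrow>
              alpha1 d A B C M \<le> 0 \<and> beta2 d A B C M \<le> 0) \<and>
         (ptolemaic_space X d \<longrightarrow>
            ({M \<in> X. d M C + d M A - d M B \<le> 0} \<noteq> {} \<longleftrightarrow> c \<ge> b \<or> a \<ge> b))"
proof (intro conjI ballI impI)
  interpret Metric_space X d by fact
  fix M
  show "d M C + d M A - d M B \<le> 0 \<longleftrightarrow> alpha1 d A B C M \<le> 0 \<and> beta2 d A B C M \<le> 0"
    unfolding alpha1_def beta2_def Let_def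
    by (rule degenerate_iff_heron_nonpos_and_obtuse) auto
next
  interpret Metric_space X d by fact
  assume pt: "ptolemaic_space X d"
  show "{M \<in> X. d M C + d M A - d M B \<le> 0} \<noteq> {} \<longleftrightarrow> c \<ge> b \<or> a \<ge> b"
  proof
    assume "{M \<in> X. d M C + d M A - d M B \<le> 0} \<noteq> {}"
    then obtain M where "M \<in> X" "d M C + d M A \<le> d M B" by auto
    then show "c \<ge> b \<or> a \<ge> b"
      using ptolemaic_degenerate_imp_not_longest[OF pt] assms by blast
  next
    assume "c \<ge> b \<or> a \<ge> b"
    then show "{M \<in> X. d M C + d M A - d M B \<le> 0} \<noteq> {}"
    proof
      assume "c \<ge> b"
      then have "A \<in> {M \<in> X. d M C + d M A - d M B \<le> 0}"
        using assms by (simp add: commute)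
      then show ?thesis by blast
    next
      assume "a \<ge> b"
      then have "C \<in> {M \<in> X. d M C + d M A - d M B \<le> 0}"
        using assms by (simp add: commute)
      then show ?thesis by blast
    qed
  qed
qed

end
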